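(* If $T$ is a cubic tree, then $A_b(C(T))=4$.
   Context: All graphs are finite and simple. Write $[k]=\{1,\dots,k\}$. A $k$-coloring of $G$ is a map $c:V(G)\to[k]$ with $c(u)\neq c(v)$ for every edge $uv$; its color classes are $V_i=\{v\in V(G): c(v)=i\}$. An acyclic $k$-coloring is a $k$-coloring such that, for any two colors $i,j$, the subgraph induced by $V_i\cup V_j$ is a forest (contains no cycle). Here a coloring "with $k$ colors" means all $k$ colors are used. Let $c$ be an acyclic coloring of $G$ with color set $[k]$. An acyclic recoloring step is possible for $c$ if there exist a color $i\in[k]$ and a choice of colors $\ell_v\in[k]\setminus\{i\}$, one for each $v\in V_i$, with $\ell_v$ not appearing under $c$ in the closed neighborhood of $v$, such that the map $c_i:V(G)\to[k]\setminus\{i\}$ defined by $c_i(v)=c(v)$ if $c(v)\neq i$ and $c_i(v)=\ell_v$ if $c(v)=i$ is again an acyclic coloring of $G$. The acyclic b-chromatic number $A_b(G)$ is the maximum number $k$ of colors in an acyclic coloring of $G$ for which no acyclic recoloring step is possible. (Equivalently, it is the maximum number of colors in a coloring obtained by starting with the trivial coloring, in which all vertices have distinct colors, and performing acyclic recoloring steps until none is possible.) A tree $T\not\cong K_1$ is called cubic if every inner (non-leaf) vertex of $T$ has degree three; thus every vertex of $T$ has degree 1 or 3, and $K_2$ is the smallest cubic tree. Let $H_3$ be the graph on seven vertices $w,u,v,x,y,p,q$ with edges $wu, wv, uv, ux, vy, xp, xq, yp, yq, pq$; the vertex $w$ has degree two and all other vertices have degree three. From a cubic tree $T$ the cubic graph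 $C(T)$ is constructed as follows. First, every inner vertex of $T$ is replaced by a triangle: an inner vertex with neighbors $x,y,z$ is replaced by a triangle $abc$ together with edges $ax,by,cz$ (so each of the three edges formerly incident with the vertex is attached to a different vertex of the triangle; after doing this for all inner vertices, an edge between two inner vertices of $T$ becomes an edge between the two corresponding triangles). Then, for every leaf of $T$, a new copy of $H_3$ is added and its vertex $w$ is identified with that leaf. *)

theory Defs
  imports Main
begin

section \<open>Finite simple graphs\<close>

record 'a ugraph =
  vertices :: "'a set"
  edges :: "'a set set"

definition simple_graph :: "'a ugraph \<Rightarrow> bool" where
  "simple_graph G \<longleftrightarrow> finite (vertices G) \<and>
     (\<forall>e\<in>edges G. \<exists>u v. u \<in> vertices G \<and> v \<in> vertices G \<and> u \<noteq> v \<and> e = {u, v})"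

definition nbrs :: "'a ugraph \<Rightarrow> 'a \<Rightarrow> 'a set" where
  "nbrs G v = {u \<in> vertices G. {u, v} \<in> edges G}"

definition degree :: "'a ugraph \<Rightarrow> 'a \<Rightarrow> nat" where
  "degree G v = card (nbrs G v)"

definition induced_subgraph :: "'a ugraph \<Rightarrow> 'a set \<Rightarrow> 'a ugraph" where
  "induced_subgraph G S = \<lparr>vertices = vertices G \<inter> S, edges = {e \<in> edges G. e \<subseteq> S}\<rparr>"

definition is_cycle :: "'a ugraph \<Rightarrow> 'a list \<Rightarrow> bool" where
  "is_cycle G p \<longleftrightarrow> 3 \<le> length p \<and> distinct p \<and> set p \<subseteq> vertices G \<and>
     (\<forall>i<length p. {p ! i, p ! (Suc i mod length p)} \<in> edges G)"

definition forest :: "'a ugraph \<Rightarrow> bool" where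
  "forest G \<longleftrightarrow> (\<nexists>p. is_cycle G p)"

definition connected_graph :: "'a ugraph \<Rightarrow> bool" where
  "connected_graph G \<longleftrightarrow> vertices G \<noteq> {} \<and>
     (\<forall>u\<in>vertices G. \<forall>v\<in>vertices G. (u, v) \<in> {(x, y). {x, y} \<in> edges G}\<^sup>*)"

definition tree :: "'a ugraph \<Rightarrow> bool" where
  "tree G \<longleftrightarrow> simple_graph G \<and> connected_graph G \<and> forest G"


section \<open>Acyclic colorings and the acyclic b-chromatic number\<close>

text \<open>The set \<open>K\<close> of available colors is explicit, because a recoloring step leads from the
  color set \<open>{1..k}\<close> to \<open>{1..k} - {i}\<close>. Not all colors of \<open>K\<close> need to be used.\<close>

definition proper_coloring :: "'a ugraph \<Rightarrow> nat set \<Rightarrow> ('a \<Rightarrow> nat) \<Rightarrow> bool" where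
  "proper_coloring G K c \<longleftrightarrow> c ` vertices G \<subseteq> K \<and>
     (\<forall>u v. {u, v} \<in> edges G \<longrightarrow> c u \<noteq> c v)"

definition color_class :: "'a ugraph \<Rightarrow> ('a \<Rightarrow> nat) \<Rightarrow> nat \<Rightarrow> 'a set" where
  "color_class G c i = {v \<in> vertices G. c v = i}"

definition acyclic_coloring :: "'a ugraph \<Rightarrow> nat set \<Rightarrow> ('a \<Rightarrow> nat) \<Rightarrow> bool" where
  "acyclic_coloring G K c \<longleftrightarrow> proper_coloring G K c \<and>
     (\<forall>i\<in>K. \<forall>j\<in>K. forest (induced_subgraph G (color_class G c i \<union> color_class G c j)))"

definition recoloring_step_possible :: "'a ugraph \<Rightarrow> nat \<Rightarrow> ('a \<Rightarrow> nat) \<Rightarrow> bool" where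
  "recoloring_step_possible G k c \<longleftrightarrow>
     (\<exists>i\<in>{1..k}. \<exists>l.
        (\<forall>v\<in>color_class G c i. l v \<in> {1..k} - {i} \<and> l v \<notin> c ` insert v (nbrs G v)) \<and>
        acyclic_coloring G ({1..k} - {i}) (\<lambda>v. if c v = i then l v else c v))"

text \<open>A coloring with \<open>k\<close> colors uses all of them, hence \<open>k \<le> card (vertices G)\<close> for every
  \<open>k\<close> in the set below and the maximum is taken over a finite set when \<open>G\<close> is finite.\<close>

definition acyclic_b_chromatic_number :: "'a ugraph \<Rightarrow> nat" where
  "acyclic_b_chromatic_number G =
     Max {k. \<exists>c. acyclic_coloring G {1..k} c \<and> c ` vertices G = {1..k} \<and>
                 \<not> recoloring_step_possible G k c}"


section \<open>Cubic trees and the cubic graph of a cubic tree\<close>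

definition leaf :: "'a ugraph \<Rightarrow> 'a \<Rightarrow> bool" where
  "leaf G v \<longleftrightarrow> v \<in> vertices G \<and> degree G v = 1"

definition inner_vertex :: "'a ugraph \<Rightarrow> 'a \<Rightarrow> bool" where
  "inner_vertex G v \<longleftrightarrow> v \<in> vertices G \<and> \<not> leaf G v"

definition cubic_tree :: "'a ugraph \<Rightarrow> bool" where
  "cubic_tree T \<longleftrightarrow> tree T \<and> card (vertices T) \<noteq> 1 \<and> (\<forall>v. inner_vertex T v \<longrightarrow> degree T v = 3)"

datatype h3_vertex = Hw | Hu | Hv | Hx | Hy | Hp | Hq

definition H3 :: "h3_vertex ugraph" where
  "H3 = \<lparr>vertices = UNIV,
         edges = {{Hw, Hu}, {Hw, Hv}, {Hu, Hv}, {Hu, Hx}, {Hv, Hy},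
                  {Hx, Hp}, {Hx, Hq}, {Hy, Hp}, {Hy, Hq}, {Hp, Hq}}\<rparr>"

text \<open>\<open>Corner t s\<close> is the vertex of the triangle replacing the inner vertex \<open>t\<close> of the tree
  that receives the former edge from \<open>t\<close> to its neighbor \<open>s\<close>. \<open>Gadget t h\<close> is the vertex \<open>h\<close>
  of the copy of \<^const>\<open>H3\<close> added for the leaf \<open>t\<close>; the leaf itself, being identified with the
  vertex \<open>w\<close> of its copy, is \<open>Gadget t Hw\<close>.\<close>

datatype 'a cubic_vertex = Corner 'a 'a | Gadget 'a h3_vertex

definition attach :: "'a ugraph \<Rightarrow> 'a \<Rightarrow> 'a \<Rightarrow> 'a cubic_vertex" where
  "attach T t s = (if leaf T t then Gadget t Hw else Corner t s)"

definition cubic_graph_of :: "'a ugraph \<Rightarrow> 'a cubic_vertex ugraph" where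
  "cubic_graph_of T =
     \<lparr>vertices = {Corner t s | t s. inner_vertex T t \<and> s \<in> nbrs T t} \<union>
                 {Gadget t h | t h. leaf T t \<and> h \<in> vertices H3},
      edges = {{Corner t r, Corner t s} | t r s.
                 inner_vertex T t \<and> r \<in> nbrs T t \<and> s \<in> nbrs T t \<and> r \<noteq> s} \<union>
              {{attach T s t, attach T t s} | s t. {s, t} \<in> edges T} \<union>
              {{Gadget t g, Gadget t h} | t g h. leaf T t \<and> {g, h} \<in> edges H3}\<rparr>"

end

theory Submission
  imports Defs
begin

text \<open>A two-colored cycle of \<open>C(T)\<close> meets the triangles and copies of \<open>H\<^sub>3\<close> in a set of tree vertices
  which, as \<open>T\<close> is a forest, contains a vertex with at most one neighbor in that set. A local
  inspection of the triangle or copy of \<open>H\<^sub>3\<close> there refutes the cycle, so \<^emph>\<open>every\<close> proper coloring of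
  \<open>C(T)\<close> is acyclic. Hence a color class can be recolored unless it contains a vertex seeing all other
  colors. As \<open>C(T)\<close> has maximum degree three, this rules out five or more colors. With four colors, a
  single copy of \<open>H\<^sub>3\<close> can be colored so as to contain such a vertex of every color, and
  this partial coloring extends greedily.\<close>

section \<open>Forests, cycles and greedy colorings in general graphs\<close>

lemma edge_simple_graph:
  assumes "simple_graph G" "{u, v} \<in> edges G"
  shows "u \<in> vertices G" "v \<in> vertices G" "u \<noteq> v"
proof -
  obtain a b where "a \<in> vertices G" "b \<in> vertices G" "a \<noteq> b" "{u, v} = {a, b}"
    using assms unfolding simple_graph_def by blast
  then show "u \<in> vertices G" "v \<in> vertices G" "u \<noteq> v"
    by (auto simp: doubleton_eq_iff)
qed

lemma mem_nbrs_iff: "simple_graph G \<Longrightarrow> u \<in> nbrs G v \<longleftrightarrow> {u, v} \<in> edges G"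
  using edge_simple_graph(1) by (auto simp: nbrs_def)

lemma finite_nbrs: "simple_graph G \<Longrightarrow> finite (nbrs G v)"
  unfolding nbrs_def simple_graph_def by simp

text \<open>The first vertex of a longest path inside \<open>S\<close> is such a vertex: a second
  neighbor in \<open>S\<close> would either prolong the path or close a cycle with an initial
  segment of it.\<close>

lemma forest_ex_at_most_one_nbr:
  assumes G: "simple_graph G" "forest G" and S: "S \<subseteq> vertices G" "S \<noteq> {}"
  shows "\<exists>t\<in>S. \<forall>r\<in>S. \<forall>s\<in>S. {r, t} \<in> edges G \<longrightarrow> {s, t} \<in> edges G \<longrightarrow> r = s"
proof (rule ccontr)
  assume "\<not> ?thesis"
  then have two: "\<exists>r\<in>S. \<exists>s\<in>S. {r, t} \<in> edges G \<and> {s, t} \<in> edges G \<and> r \<noteq> s" if "t \<in> S" for t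
    using that by blast
  define P where "P = (\<lambda>xs. xs \<noteq> [] \<and> distinct xs \<and> set xs \<subseteq> S \<and>
    (\<forall>i. Suc i < length xs \<longrightarrow> {xs ! i, xs ! Suc i} \<in> edges G))"
  have fin: "finite S"
    using G S finite_subset unfolding simple_graph_def by blast
  obtain a where "a \<in> S" using S by blast
  then have "P [a]" by (simp add: P_def)
  moreover have "\<forall>xs. P xs \<longrightarrow> length xs < Suc (card S)"
    unfolding P_def by (metis card_mono distinct_card fin le_imp_less_Suc)
  ultimately obtain xs where xs: "P xs" and max: "\<And>ys. P ys \<Longrightarrow> length ys \<le> length xs"
    using ex_has_greatest_nat[of P "[a]" length "Suc (card S)"] by blast
  define t where "t = xs ! 0"
  have len: "0 < length xs" using xs by (simp add: P_def)
  then have "t \<in> S" using xs nth_mem unfolding P_def t_def by blast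
  \<comment> \<open>If the path is a single vertex, \<open>xs ! 1\<close> is out of range. This is
    harmless: of two distinct neighbors, one differs from whatever value it has.\<close>
  from two[OF this] obtain z where z: "z \<in> S" "{z, t} \<in> edges G" "z \<noteq> xs ! 1"
    by metis
  have "z \<in> set xs"
  proof (rule ccontr)
    assume "z \<notin> set xs"
    then have "P (z # xs)"
      using xs z unfolding P_def t_def by (auto simp: nth_Cons split: nat.splits)
    then show False using max[of "z # xs"] by simp
  qed
  then obtain j where j: "j < length xs" "z = xs ! j" by (metis in_set_conv_nth)
  have "j \<noteq> 0" using j z edge_simple_graph(3)[OF G(1) z(2)] t_def by metis
  moreover have "j \<noteq> 1" using j z by auto
  ultimately have j2: "2 \<le> j" by simp
  \<comment> \<open>The edge from \<open>xs ! j\<close> back to \<open>t\<close> closes the segment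
    \<open>xs ! 0\<close>, ..., \<open>xs ! j\<close>, which has at least three vertices because
    \<open>2 \<le> j\<close>.\<close>
  have "is_cycle G (take (Suc j) xs)"
    unfolding is_cycle_def
  proof (intro conjI allI impI)
    show "3 \<le> length (take (Suc j) xs)" using j j2 by simp
    show "distinct (take (Suc j) xs)" using xs by (simp add: P_def)
    show "set (take (Suc j) xs) \<subseteq> vertices G"
      using xs S set_take_subset[of "Suc j" xs] by (auto simp: P_def)
    fix i assume i: "i < length (take (Suc j) xs)"
    have l: "length (take (Suc j) xs) = Suc j" using j by simp
    show "{take (Suc j) xs ! i, take (Suc j) xs ! (Suc i mod length (take (Suc j) xs))} \<in> edges G"
    proof (cases "i = j")
      case True
      then show ?thesis using z j l by (simp add: t_def)
    next
      case False
      then have "i < j" using i l by simp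
      then show ?thesis using xs j l by (simp add: P_def)
    qed
  qed
  then show False using G(2) unfolding forest_def by blast
qed

lemma cycle_two_nbrs:
  assumes p: "is_cycle G p" and z: "z \<in> set p"
  shows "\<exists>y\<in>set p. \<exists>y'\<in>set p. y \<noteq> y' \<and> {z, y} \<in> edges G \<and> {z, y'} \<in> edges G"
proof -
  define n where "n = length p"
  have n: "3 \<le> n" and d: "distinct p"
    and e: "\<And>i. i < n \<Longrightarrow> {p ! i, p ! (Suc i mod n)} \<in> edges G"
    using p unfolding is_cycle_def n_def by auto
  obtain i where i: "i < n" "z = p ! i" using z unfolding n_def by (metis in_set_conv_nth)
  \<comment> \<open>The cyclic predecessor of \<open>i\<close>; it differs from the cyclic successor
    since the length is at least 3.\<close>
  define j where "j = (if i = 0 then n - 1 else i - 1)"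
  have j: "j < n" "Suc j mod n = i" using i n unfolding j_def by auto
  have "Suc i mod n \<noteq> j"
    using i n unfolding j_def by (cases "Suc i = n") auto
  moreover have "Suc i mod n < n" using n by simp
  ultimately have "p ! (Suc i mod n) \<noteq> p ! j" "p ! (Suc i mod n) \<in> set p" "p ! j \<in> set p"
    using d j(1) unfolding n_def by (auto simp: nth_eq_iff_index_eq)
  moreover have "{z, p ! (Suc i mod n)} \<in> edges G" using e i by simp
  moreover have "{z, p ! j} \<in> edges G" using e[OF j(1)] j i by (simp add: insert_commute)
  ultimately show ?thesis by blast
qed

lemma is_cycle_induced_subgraph:
  "is_cycle (induced_subgraph G S) p \<Longrightarrow> is_cycle G p \<and> set p \<subseteq> S"
  unfolding is_cycle_def induced_subgraph_def by auto

text \<open>The vertices of \<open>W\<close> outside \<open>S\<close> are colored one at a time;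
  each has fewer neighbors than there are colors, so some color is free for it. \<open>W\<close> may
  overlap \<open>S\<close>, where the given colors are kept.\<close>

lemma greedy_extension:
  assumes deg: "\<And>v. v \<in> W \<Longrightarrow> card (nbrs G v) < card K"
    and G: "simple_graph G"
    and S: "c ` S \<subseteq> K" "\<And>u v. u \<in> S \<Longrightarrow> v \<in> S \<Longrightarrow> {u, v} \<in> edges G \<Longrightarrow> c u \<noteq> c v"
    and W: "finite W"
  shows "\<exists>c'. (\<forall>v\<in>S. c' v = c v) \<and> c' ` (S \<union> W) \<subseteq> K \<and>
    (\<forall>u\<in>S \<union> W. \<forall>v\<in>S \<union> W. {u, v} \<in> edges G \<longrightarrow> c' u \<noteq> c' v)"
  using W deg
proof (induction W rule: finite_induct)
  case empty
  then show ?case using S by auto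
next
  case (insert x W)
  then obtain c' where c': "\<forall>v\<in>S. c' v = c v" "c' ` (S \<union> W) \<subseteq> K"
    "\<forall>u\<in>S \<union> W. \<forall>v\<in>S \<union> W. {u, v} \<in> edges G \<longrightarrow> c' u \<noteq> c' v" by auto
  show ?case
  proof (cases "x \<in> S")
    case True
    then have "S \<union> insert x W = S \<union> W" by auto
    then show ?thesis using c' by metis
  next
    case False
    \<comment> \<open>All neighbors are counted, including those not colored yet; avoiding their
      arbitrary values too costs nothing under the degree bound.\<close>
    have "card (c' ` nbrs G x) < card K"
      using card_image_le[OF finite_nbrs[OF G], of c' x] insert.prems[of x] by simp
    then have "\<not> K \<subseteq> c' ` nbrs G x"
      using card_mono[of "c' ` nbrs G x" K] finite_nbrs[OF G] by auto
    then obtain a where a: "a \<in> K" "a \<notin> c' ` nbrs G x" by blast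
    then have a': "c' u \<noteq> a" if "{u, x} \<in> edges G" for u
      using that mem_nbrs_iff[OF G] by blast
    have irr: "{x, x} \<notin> edges G" using edge_simple_graph(3)[OF G] by blast
    let ?c = "c'(x := a)"
    have "\<forall>v\<in>S. ?c v = c v" using c' False by auto
    moreover have "?c ` (S \<union> insert x W) \<subseteq> K" using c' a by auto
    moreover have "\<forall>u\<in>S \<union> insert x W. \<forall>v\<in>S \<union> insert x W. {u, v} \<in> edges G \<longrightarrow> ?c u \<noteq> ?c v"
      using c'(3) a' irr by (auto simp: insert_commute)
    ultimately show ?thesis by blast
  qed
qed

section \<open>The graph \<open>H3\<close>\<close>

lemma H3_edge_iff:
  "{g, h} \<in> edges H3 \<longleftrightarrow> (g, h) \<in>
    {(Hw, Hu), (Hw, Hv), (Hu, Hv), (Hu, Hx), (Hv, Hy), (Hx, Hp), (Hx, Hq), (Hy, Hp), (Hy, Hq), (Hp, Hq),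
     (Hu, Hw), (Hv, Hw), (Hv, Hu), (Hx, Hu), (Hy, Hv), (Hp, Hx), (Hq, Hx), (Hp, Hy), (Hq, Hy), (Hq, Hp)}"
  unfolding H3_def by (auto simp: doubleton_eq_iff)

text \<open>\<open>A\<close> stands for the part of a two-colored cycle inside one copy of
  \<open>H3\<close>, and \<open>b\<close> tells the two colors apart. At \<open>Hw\<close> the cycle
  may leave the copy, so only one inner neighbor is demanded there. The obstruction is parity:
  triangles and pentagons are not two-colorable.\<close>

lemma H3_no_two_colored_core:
  assumes proper: "\<And>g h. g \<in> A \<Longrightarrow> h \<in> A \<Longrightarrow> {g, h} \<in> edges H3 \<Longrightarrow> b g \<noteq> (b h :: bool)"
    and two: "\<And>g. g \<in> A \<Longrightarrow> g \<noteq> Hw \<Longrightarrow>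
      \<exists>h\<in>A. \<exists>h'\<in>A. h \<noteq> h' \<and> {g, h} \<in> edges H3 \<and> {g, h'} \<in> edges H3"
    and one: "Hw \<in> A \<Longrightarrow> \<exists>h\<in>A. {Hw, h} \<in> edges H3"
  shows "A = {}"
proof -
  have w: "Hw \<in> A \<Longrightarrow> Hu \<in> A \<or> Hv \<in> A" using one unfolding H3_edge_iff by auto
  have u: "Hu \<in> A \<Longrightarrow> Hw \<in> A \<and> Hv \<in> A \<or> Hw \<in> A \<and> Hx \<in> A \<or> Hv \<in> A \<and> Hx \<in> A"
    using two[of Hu] unfolding H3_edge_iff by auto
  have v: "Hv \<in> A \<Longrightarrow> Hw \<in> A \<and> Hu \<in> A \<or> Hw \<in> A \<and> Hy \<in> A \<or> Hu \<in> A \<and> Hy \<in> A"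
    using two[of Hv] unfolding H3_edge_iff by auto
  have x: "Hx \<in> A \<Longrightarrow> Hu \<in> A \<and> Hp \<in> A \<or> Hu \<in> A \<and> Hq \<in> A \<or> Hp \<in> A \<and> Hq \<in> A"
    using two[of Hx] unfolding H3_edge_iff by auto
  have y: "Hy \<in> A \<Longrightarrow> Hv \<in> A \<and> Hp \<in> A \<or> Hv \<in> A \<and> Hq \<in> A \<or> Hp \<in> A \<and> Hq \<in> A"
    using two[of Hy] unfolding H3_edge_iff by auto
  have p: "Hp \<in> A \<Longrightarrow> Hx \<in> A \<and> Hy \<in> A \<or> Hx \<in> A \<and> Hq \<in> A \<or> Hy \<in> A \<and> Hq \<in> A"
    using two[of Hp] unfolding H3_edge_iff by auto
  have q: "Hq \<in> A \<Longrightarrow> Hx \<in> A \<and> Hy \<in> A \<or> Hx \<in> A \<and> Hp \<in> A \<or> Hy \<in> A \<and> Hp \<in> A"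
    using two[of Hq] unfolding H3_edge_iff by auto
  have wuv: "\<not> (Hw \<in> A \<and> Hu \<in> A \<and> Hv \<in> A)"
    using proper[of Hw Hu] proper[of Hw Hv] proper[of Hu Hv] unfolding H3_edge_iff by auto
  have xpq: "\<not> (Hx \<in> A \<and> Hp \<in> A \<and> Hq \<in> A)"
    using proper[of Hx Hp] proper[of Hx Hq] proper[of Hp Hq] unfolding H3_edge_iff by auto
  have ypq: "\<not> (Hy \<in> A \<and> Hp \<in> A \<and> Hq \<in> A)"
    using proper[of Hy Hp] proper[of Hy Hq] proper[of Hp Hq] unfolding H3_edge_iff by auto
  \<comment> \<open>The 5-cycle is \<open>Hu\<close>, \<open>Hv\<close>, \<open>Hy\<close>,
    \<open>g\<close>, \<open>Hx\<close>.\<close>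
  have pentagon: "\<not> (Hu \<in> A \<and> Hv \<in> A \<and> Hx \<in> A \<and> Hy \<in> A \<and> g \<in> A)" if "g = Hp \<or> g = Hq" for g
    using that proper[of Hu Hv] proper[of Hu Hx] proper[of Hv Hy] proper[of Hx g] proper[of Hy g]
    unfolding H3_edge_iff by auto
  \<comment> \<open>If \<open>Hp\<close> or \<open>Hq\<close> is in \<open>A\<close>, the triangles
    through both force \<open>Hx\<close> and \<open>Hy\<close> into \<open>A\<close> and the other
    of the two out, whence \<open>Hu\<close> and \<open>Hv\<close> are in \<open>A\<close>, against
    the pentagon. Without \<open>Hp\<close> and \<open>Hq\<close>, neither \<open>Hx\<close> nor
    \<open>Hy\<close> has two neighbors in \<open>A\<close>, and only the triangle at
    \<open>Hw\<close> remains.\<close>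
  have "h \<notin> A" for h
    using w u v x y p q wuv xpq ypq pentagon[of Hp] pentagon[of Hq] by (cases h; metis)
  then show ?thesis by blast
qed

section \<open>Edges of \<open>C(T)\<close> and the projection \<open>owner\<close>, which contracts
  each triangle and each copy of \<open>H3\<close> to its tree vertex\<close>

fun owner :: "'a cubic_vertex \<Rightarrow> 'a" where
  "owner (Corner t s) = t"
| "owner (Gadget t h) = t"

lemma owner_attach [simp]: "owner (attach T t s) = t"
  by (simp add: attach_def)

text \<open>Each of the three kinds of edges is symmetric in its ends, so the unordered pair may be
  matched in the given order; this spares the later case analyses the swapped cases.\<close>

lemma cubic_graph_edge_iff:
  "{y, z} \<in> edges (cubic_graph_of T) \<longleftrightarrow>
     (\<exists>t r s. inner_vertex T t \<and> r \<in> nbrs T t \<and> s \<in> nbrs T t \<and> r \<noteq> s \<and> y = Corner t r \<and> z = Corner t s) \<or>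
     (\<exists>s t. {s, t} \<in> edges T \<and> y = attach T s t \<and> z = attach T t s) \<or>
     (\<exists>t g h. leaf T t \<and> {g, h} \<in> edges H3 \<and> y = Gadget t g \<and> z = Gadget t h)"
  (is "_ \<longleftrightarrow> ?A \<or> ?B \<or> ?C")
proof
  assume "{y, z} \<in> edges (cubic_graph_of T)"
  then consider
      t r s where "inner_vertex T t" "r \<in> nbrs T t" "s \<in> nbrs T t" "r \<noteq> s" "{y, z} = {Corner t r, Corner t s}"
    | s t where "{s, t} \<in> edges T" "{y, z} = {attach T s t, attach T t s}"
    | t g h where "leaf T t" "{g, h} \<in> edges H3" "{y, z} = {Gadget t g, Gadget t h}"
    unfolding cubic_graph_of_def by auto
  then show "?A \<or> ?B \<or> ?C"
  proof cases
    case 1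
    then show ?thesis unfolding doubleton_eq_iff by metis
  next
    case 2
    then show ?thesis unfolding doubleton_eq_iff by (metis insert_commute)
  next
    case 3
    then show ?thesis unfolding doubleton_eq_iff by (metis insert_commute)
  qed
next
  assume "?A \<or> ?B \<or> ?C"
  then show "{y, z} \<in> edges (cubic_graph_of T)"
    unfolding cubic_graph_of_def by auto
qed

section \<open>Neighborhoods in \<open>C(T)\<close> for a cubic tree\<close>

context
  fixes T :: "'a ugraph"
  assumes T: "cubic_tree T"
begin

lemma simple_T: "simple_graph T" and forest_T: "forest T" and nonempty_T: "vertices T \<noteq> {}"
  using T unfolding cubic_tree_def tree_def connected_graph_def by auto

lemma degree_inner: "inner_vertex T t \<Longrightarrow> card (nbrs T t) = 3"
  using T unfolding cubic_tree_def degree_def by blast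

lemma degree_leaf: "leaf T t \<Longrightarrow> card (nbrs T t) = 1"
  unfolding leaf_def degree_def by blast

lemma leaf_or_inner: "t \<in> vertices T \<Longrightarrow> leaf T t \<or> inner_vertex T t"
  unfolding inner_vertex_def by blast

lemma not_inner_leaf: "leaf T t \<Longrightarrow> \<not> inner_vertex T t"
  unfolding inner_vertex_def by blast

text \<open>The forest lemma, applied to all vertices of \<open>T\<close>, yields a vertex of degree
  at most one. Inner vertices have degree three, so it is a leaf.\<close>

lemma ex_leaf: "\<exists>t. leaf T t"
proof -
  obtain t where t: "t \<in> vertices T" and
    one: "\<And>r s. {r, t} \<in> edges T \<Longrightarrow> {s, t} \<in> edges T \<Longrightarrow> r = s"
    using forest_ex_at_most_one_nbr[OF simple_T forest_T subset_refl nonempty_T]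
      edge_simple_graph(1)[OF simple_T] by metis
  have "card (nbrs T t) \<le> Suc 0"
    using one mem_nbrs_iff[OF simple_T] finite_nbrs[OF simple_T] by (simp add: card_le_Suc0_iff_eq)
  then show ?thesis using t degree_inner leaf_or_inner by fastforce
qed

lemma attach_mem:
  assumes "{s, t} \<in> edges T"
  shows "attach T s t \<in> vertices (cubic_graph_of T)"
proof -
  have "s \<in> vertices T" "t \<in> nbrs T s"
    using assms edge_simple_graph[OF simple_T assms] mem_nbrs_iff[OF simple_T]
    by (simp_all add: insert_commute)
  then show ?thesis
    using leaf_or_inner unfolding attach_def cubic_graph_of_def by (auto simp: H3_def)
qed

lemma simple_cubic_graph: "simple_graph (cubic_graph_of T)"
proof -
  have fin: "finite (vertices T)" using simple_T by (simp add: simple_graph_def)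
  have "vertices (cubic_graph_of T) \<subseteq>
      (\<lambda>(t, s). Corner t s) ` (vertices T \<times> vertices T) \<union>
      (\<lambda>(t, h). Gadget t h) ` (vertices T \<times> {Hw, Hu, Hv, Hx, Hy, Hp, Hq})"
    unfolding cubic_graph_of_def inner_vertex_def leaf_def nbrs_def
    by (auto simp: image_iff) (metis h3_vertex.exhaust)
  moreover have "finite \<dots>" using fin by auto
  ultimately have "finite (vertices (cubic_graph_of T))" by (rule finite_subset)
  moreover have "\<exists>u v. u \<in> vertices (cubic_graph_of T) \<and> v \<in> vertices (cubic_graph_of T) \<and> u \<noteq> v \<and> e = {u, v}"
    if "e \<in> edges (cubic_graph_of T)" for e
  proof -
    from that consider
      t r s where "inner_vertex T t" "r \<in> nbrs T t" "s \<in> nbrs T t" "r \<noteq> s" "e = {Corner t r, Corner t s}"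
    | s t where "{s, t} \<in> edges T" "e = {attach T s t, attach T t s}"
    | t g h where "leaf T t" "{g, h} \<in> edges H3" "e = {Gadget t g, Gadget t h}"
      unfolding cubic_graph_of_def by auto
    then show ?thesis
    proof cases
      case 1
      then show ?thesis unfolding cubic_graph_of_def by auto
    next
      case 2
      then have "attach T s t \<noteq> attach T t s"
        using edge_simple_graph(3)[OF simple_T] owner_attach by metis
      moreover have "{t, s} \<in> edges T" using 2 by (simp add: insert_commute)
      ultimately show ?thesis using 2 attach_mem by blast
    next
      case 3
      then have "g \<noteq> h" unfolding H3_edge_iff by auto
      moreover have "Gadget t x \<in> vertices (cubic_graph_of T)" for x
        using 3(1) by (simp add: cubic_graph_of_def H3_def)
      ultimately show ?thesis using 3(3) by blast
    qed
  qed
  ultimately show ?thesis unfolding simple_graph_def by blast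
qed

text \<open>Edges between different owners come from edges of \<open>T\<close>, and their ends are
  determined by the two owners. Hence two tree vertices are joined by at most one edge of
  \<open>C(T)\<close>, which lets the forest property of \<open>T\<close> act on cycles of
  \<open>C(T)\<close>.\<close>

lemma edge_other_owner:
  assumes "{y, z} \<in> edges (cubic_graph_of T)" "owner y \<noteq> owner z"
  shows "{owner y, owner z} \<in> edges T" "y = attach T (owner y) (owner z)" "z = attach T (owner z) (owner y)"
  using assms unfolding cubic_graph_edge_iff by auto

lemma edge_same_owner_corner:
  assumes "{Corner t s, z} \<in> edges (cubic_graph_of T)" "owner z = t"
  obtains r where "z = Corner t r" "r \<noteq> s" "r \<in> nbrs T t"
  using assms edge_simple_graph(3)[OF simple_T] unfolding cubic_graph_edge_iff
  by (auto) (metis owner_attach owner.simps(1))+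

lemma edge_corner_other_owner:
  assumes "{Corner t s, z} \<in> edges (cubic_graph_of T)" "owner z \<noteq> t"
  shows "z = attach T s t"
  using assms unfolding cubic_graph_edge_iff by (auto simp: attach_def split: if_splits)

lemma edge_gadget_same_owner:
  assumes "{Gadget t h, z} \<in> edges (cubic_graph_of T)" "owner z = t"
  obtains g where "z = Gadget t g" "{h, g} \<in> edges H3"
  using assms edge_simple_graph(3)[OF simple_T] unfolding cubic_graph_edge_iff
  by (auto) (metis owner_attach owner.simps(2))+

lemma edge_gadget_other_owner:
  assumes "{Gadget t h, z} \<in> edges (cubic_graph_of T)" "owner z \<noteq> t"
  shows "h = Hw" "\<exists>s\<in>nbrs T t. z = attach T s t"
  using edge_other_owner[OF assms(1)] assms(2) mem_nbrs_iff[OF simple_T]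
  by (auto simp: attach_def insert_commute split: if_splits)

text \<open>A corner has two neighbors in its triangle and one outside. In \<open>H3\<close> only
  \<open>Hw\<close> has an edge leaving the copy, and it has just two neighbors inside.\<close>

lemma degree_cubic_graph:
  assumes z: "z \<in> vertices (cubic_graph_of T)"
  shows "card (nbrs (cubic_graph_of T) z) \<le> 3"
proof (cases z)
  case (Corner t s)
  then have t: "inner_vertex T t" "s \<in> nbrs T t" using z unfolding cubic_graph_of_def by auto
  have "nbrs (cubic_graph_of T) z \<subseteq> insert (attach T s t) (Corner t ` (nbrs T t - {s}))"
  proof
    fix y assume "y \<in> nbrs (cubic_graph_of T) z"
    then have e: "{Corner t s, y} \<in> edges (cubic_graph_of T)"
      using Corner by (simp add: nbrs_def insert_commute)
    show "y \<in> insert (attach T s t) (Corner t ` (nbrs T t - {s}))"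
    proof (cases "owner y = t")
      case True
      then obtain r where "y = Corner t r" "r \<noteq> s" "r \<in> nbrs T t"
        by (rule edge_same_owner_corner[OF e])
      then show ?thesis by simp
    next
      case False
      then show ?thesis using edge_corner_other_owner[OF e] by simp
    qed
  qed
  moreover have "card (insert (attach T s t) (Corner t ` (nbrs T t - {s}))) \<le> 3"
  proof -
    have "card (Corner t ` (nbrs T t - {s})) \<le> 2"
      using card_image_le[of "nbrs T t - {s}" "Corner t"] finite_nbrs[OF simple_T] degree_inner[OF t(1)] t(2)
      by (simp add: card_Diff_singleton)
    then show ?thesis using card_insert_le_m1[of 3] by simp
  qed
  ultimately show ?thesis
    using card_mono[of "insert (attach T s t) (Corner t ` (nbrs T t - {s}))"] finite_nbrs[OF simple_T]
    by (meson finite_Diff finite_imageI finite_insert le_trans)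
next
  case (Gadget t h)
  then have t: "leaf T t" using z unfolding cubic_graph_of_def by auto
  obtain s where s: "nbrs T t = {s}" using degree_leaf[OF t] card_1_singletonE by blast
  define X where "X = (if h = Hw then {attach T s t} else {}) \<union> Gadget t ` {g. {h, g} \<in> edges H3}"
  have "nbrs (cubic_graph_of T) z \<subseteq> X"
  proof
    fix y assume "y \<in> nbrs (cubic_graph_of T) z"
    then have e: "{Gadget t h, y} \<in> edges (cubic_graph_of T)"
      using Gadget by (simp add: nbrs_def insert_commute)
    show "y \<in> X"
    proof (cases "owner y = t")
      case True
      then obtain g where "y = Gadget t g" "{h, g} \<in> edges H3"
        by (rule edge_gadget_same_owner[OF e])
      then show ?thesis unfolding X_def by simp
    next
      case False
      then show ?thesis using edge_gadget_other_owner[OF e] s unfolding X_def by auto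
    qed
  qed
  moreover have "\<exists>a b d. X \<subseteq> {a, b, d}"
    unfolding X_def H3_edge_iff by (cases h) auto
  ultimately obtain a b d where "nbrs (cubic_graph_of T) z \<subseteq> {a, b, d}" by blast
  then have "card (nbrs (cubic_graph_of T) z) \<le> card {a, b, d}" by (intro card_mono) auto
  also have "\<dots> \<le> 3" by (simp add: card_insert_if)
  finally show ?thesis .
qed

text \<open>With this, a recoloring only has to stay proper. The color set is arbitrary because both
  \<open>{1..k}\<close> and \<open>{1..k} - {1}\<close> occur.\<close>

lemma proper_imp_acyclic:
  assumes proper: "proper_coloring (cubic_graph_of T) K c"
  shows "acyclic_coloring (cubic_graph_of T) K c"
  unfolding acyclic_coloring_def forest_def
proof (intro conjI ballI notI, fact proper, elim exE)
  fix i j p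
  let ?G = "cubic_graph_of T"
  assume "is_cycle (induced_subgraph ?G (color_class ?G c i \<union> color_class ?G c j)) p"
  then have p: "is_cycle ?G p" and sub: "set p \<subseteq> color_class ?G c i \<union> color_class ?G c j"
    using is_cycle_induced_subgraph by blast+
  define S where "S = set p"
  have V: "S \<subseteq> vertices ?G" and ne: "S \<noteq> {}" using p unfolding is_cycle_def S_def by auto
  have two: "\<exists>y\<in>S. \<exists>y'\<in>S. y \<noteq> y' \<and> {z, y} \<in> edges ?G \<and> {z, y'} \<in> edges ?G" if "z \<in> S" for z
    using cycle_two_nbrs[OF p] that unfolding S_def by blast
  \<comment> \<open>Only the colors \<open>i\<close> and \<open>j\<close> occur on \<open>S\<close>,
    so one Boolean separates the ends of every edge within \<open>S\<close>.\<close>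
  define b where "b = (\<lambda>z. c z = i)"
  have b: "b y \<noteq> b z" if "y \<in> S" "z \<in> S" "{y, z} \<in> edges ?G" for y z
  proof -
    have "c y \<noteq> c z" using proper that unfolding proper_coloring_def by blast
    then show ?thesis using sub that unfolding S_def b_def color_class_def by auto
  qed
  have "owner ` S \<subseteq> vertices T"
    using V unfolding cubic_graph_of_def inner_vertex_def leaf_def by auto
  then obtain t where t: "t \<in> owner ` S" and one: "\<And>r s. r \<in> owner ` S \<Longrightarrow> s \<in> owner ` S \<Longrightarrow>
      {r, t} \<in> edges T \<Longrightarrow> {s, t} \<in> edges T \<Longrightarrow> r = s"
    using forest_ex_at_most_one_nbr[OF simple_T forest_T, of "owner ` S"] ne by blast
  \<comment> \<open>All edges by which \<open>S\<close> leaves the piece over \<open>t\<close> end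
    in one vertex: the owners outside agree by the choice of \<open>t\<close>, and an edge between
    two pieces is determined by its owners.\<close>
  have only: "z = z'" if "y \<in> S" "owner y = t" "z \<in> S" "z' \<in> S" "y' \<in> S" "owner y' = t"
      "{y, z} \<in> edges ?G" "{y', z'} \<in> edges ?G" "owner z \<noteq> t" "owner z' \<noteq> t" for y y' z z'
  proof -
    have "{owner z, t} \<in> edges T" "{owner z', t} \<in> edges T"
      using edge_other_owner(1)[OF that(7)] edge_other_owner(1)[OF that(8)] that
      by (auto simp: insert_commute)
    then have "owner z = owner z'" using one that by blast
    then show ?thesis using edge_other_owner(3)[OF that(7)] edge_other_owner(3)[OF that(8)] that by simp
  qed
  have "t \<in> vertices T" using t \<open>owner ` S \<subseteq> vertices T\<close> by blast
  then consider "inner_vertex T t" | "leaf T t" using leaf_or_inner by blast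
  then show False
  proof cases
    case 1
    \<comment> \<open>Of the two cycle neighbors of a corner, not both lie in its triangle, which
      would then be two-colored, and at most one lies outside. So there is one of each, and two
      corners leave the triangle for different owners, contradicting \<open>only\<close>.\<close>
    have out: "attach T s t \<in> S \<and> {Corner t s, attach T s t} \<in> edges ?G \<and> owner (attach T s t) \<noteq> t \<and>
        (\<exists>r. r \<noteq> s \<and> Corner t r \<in> S)"
      if s: "Corner t s \<in> S" for s
    proof -
      obtain y y' where y: "y \<in> S" "y' \<in> S" "y \<noteq> y'" "{Corner t s, y} \<in> edges ?G" "{Corner t s, y'} \<in> edges ?G"
        using two[OF s] by blast
      have "owner y \<noteq> t \<or> owner y' \<noteq> t"
      proof (rule ccontr)
        assume "\<not> ?thesis"
        then have o: "owner y = t" "owner y' = t" by simp_all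
        obtain r where r: "y = Corner t r" "r \<in> nbrs T t"
          using edge_same_owner_corner[OF y(4) o(1)] .
        obtain r' where r': "y' = Corner t r'" "r' \<in> nbrs T t"
          using edge_same_owner_corner[OF y(5) o(2)] .
        have "{y, y'} \<in> edges ?G"
          using 1 y(3) r r' unfolding cubic_graph_edge_iff by blast
        then show False using b[OF s y(1) y(4)] b[OF s y(2) y(5)] b[OF y(1,2)] by blast
      qed
      moreover have "owner y = t \<or> owner y' = t"
        using edge_corner_other_owner[OF y(4)] edge_corner_other_owner[OF y(5)] y(3) by blast
      ultimately obtain x x' where x: "x \<in> S" "{Corner t s, x} \<in> edges ?G" "owner x = t"
        and x': "x' \<in> S" "{Corner t s, x'} \<in> edges ?G" "owner x' \<noteq> t"
        using y by blast
      obtain r where "x = Corner t r" "r \<noteq> s"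
        using edge_same_owner_corner[OF x(2,3)] .
      then show ?thesis using x x' edge_corner_other_owner[OF x'(2,3)] by blast
    qed
    obtain z where z: "z \<in> S" "owner z = t" using t by blast
    then obtain s where s: "Corner t s \<in> S"
      using V not_inner_leaf 1 unfolding cubic_graph_of_def by (cases z) auto
    then obtain r where r: "r \<noteq> s" "Corner t r \<in> S" using out by blast
    have "attach T r t = attach T s t"
      using only[of "Corner t r" "attach T r t" "attach T s t" "Corner t s"] out[OF s] out[OF r(2)] s r by simp
    then have "r = s" using owner_attach by metis
    then show False using r by blast
  next
    case 2
    \<comment> \<open>Vertices other than \<open>Hw\<close> keep both cycle neighbors inside the
      copy; \<open>Hw\<close> keeps at least one, since by \<open>only\<close> two outside neighbors
      would coincide.\<close>
    define A where "A = {h. Gadget t h \<in> S}"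
    have "A = {}"
    proof (rule H3_no_two_colored_core[where b = "\<lambda>h. b (Gadget t h)"])
      fix g h assume "g \<in> A" "h \<in> A" "{g, h} \<in> edges H3"
      then show "b (Gadget t g) \<noteq> b (Gadget t h)"
        using 2 by (intro b) (auto simp: A_def cubic_graph_edge_iff)
    next
      fix g assume g: "g \<in> A" "g \<noteq> Hw"
      then obtain y y' where y: "y \<in> S" "y' \<in> S" "y \<noteq> y'"
          "{Gadget t g, y} \<in> edges ?G" "{Gadget t g, y'} \<in> edges ?G"
        using two unfolding A_def by blast
      then have o: "owner y = t" "owner y' = t" using edge_gadget_other_owner(1) g by blast+
      obtain h where h: "y = Gadget t h" "{g, h} \<in> edges H3"
        using edge_gadget_same_owner[OF y(4) o(1)] .
      obtain h' where h': "y' = Gadget t h'" "{g, h'} \<in> edges H3"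
        using edge_gadget_same_owner[OF y(5) o(2)] .
      have "h \<in> A" "h' \<in> A" "h \<noteq> h'" using y h h' by (simp_all add: A_def)
      then show "\<exists>h\<in>A. \<exists>h'\<in>A. h \<noteq> h' \<and> {g, h} \<in> edges H3 \<and> {g, h'} \<in> edges H3"
        using h(2) h'(2) by blast
    next
      assume w: "Hw \<in> A"
      then obtain y y' where y: "y \<in> S" "y' \<in> S" "y \<noteq> y'"
          "{Gadget t Hw, y} \<in> edges ?G" "{Gadget t Hw, y'} \<in> edges ?G"
        using two unfolding A_def by blast
      then have "owner y = t \<or> owner y' = t"
        using only[of "Gadget t Hw" y y' "Gadget t Hw"] w unfolding A_def by auto
      then obtain x where x: "x \<in> S" "{Gadget t Hw, x} \<in> edges ?G" "owner x = t"
        using y by blast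
      obtain h where "x = Gadget t h" "{Hw, h} \<in> edges H3"
        using edge_gadget_same_owner[OF x(2,3)] .
      then show "\<exists>h\<in>A. {Hw, h} \<in> edges H3"
        using x(1) by (auto simp: A_def)
    qed
    moreover obtain z where z: "z \<in> S" "owner z = t" using t by blast
    then have "\<exists>h. Gadget t h \<in> S"
      using V not_inner_leaf[OF 2] unfolding cubic_graph_of_def by (cases z) auto
    ultimately show False unfolding A_def by blast
  qed
qed

text \<open>A closed neighborhood has at most four vertices, so every vertex misses some color.
  Color class 1 is independent, so its vertices can move to missing colors without conflicting with
  each other.\<close>

lemma recoloring_step_if_five_colors:
  assumes k: "5 \<le> k" and c: "acyclic_coloring (cubic_graph_of T) {1..k} c"
  shows "recoloring_step_possible (cubic_graph_of T) k c"
proof -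
  let ?G = "cubic_graph_of T"
  have "\<exists>a. a \<in> {1..k} \<and> a \<notin> c ` insert v (nbrs ?G v)" if "v \<in> vertices ?G" for v
  proof -
    have fin: "finite (nbrs ?G v)" by (rule finite_nbrs[OF simple_cubic_graph])
    have "card (c ` insert v (nbrs ?G v)) \<le> card (insert v (nbrs ?G v))"
      using fin by (intro card_image_le) simp
    also have "\<dots> < card {1..k}"
      using degree_cubic_graph[OF that] k fin by (simp add: card_insert_if)
    finally have "\<not> {1..k} \<subseteq> c ` insert v (nbrs ?G v)"
      using card_mono[of "c ` insert v (nbrs ?G v)" "{1..k}"] fin by auto
    then show ?thesis by blast
  qed
  then obtain l where l: "\<And>v. v \<in> vertices ?G \<Longrightarrow> l v \<in> {1..k} \<and> l v \<notin> c ` insert v (nbrs ?G v)"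
    by metis
  define c' where "c' = (\<lambda>v. if c v = 1 then l v else c v)"
  have pc: "c ` vertices ?G \<subseteq> {1..k}" "\<And>u v. {u, v} \<in> edges ?G \<Longrightarrow> c u \<noteq> c v"
    using c unfolding acyclic_coloring_def proper_coloring_def by auto
  have free: "l u \<noteq> c v" if "{u, v} \<in> edges ?G" for u v
    using that l[of u] edge_simple_graph[OF simple_cubic_graph that] mem_nbrs_iff[OF simple_cubic_graph]
    by (auto simp: insert_commute)
  have "proper_coloring ?G ({1..k} - {1}) c'"
    unfolding proper_coloring_def
  proof (intro conjI allI impI)
    show "c' ` vertices ?G \<subseteq> {1..k} - {1}"
    proof
      fix a assume "a \<in> c' ` vertices ?G"
      then obtain v where v: "v \<in> vertices ?G" "a = c' v" by blast
      have "c v \<in> {1..k}" using pc(1) v(1) by blast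
      then show "a \<in> {1..k} - {1}" using l[OF v(1)] v(2) by (auto simp: c'_def)
    qed
    fix u v assume e: "{u, v} \<in> edges ?G"
    then have "{v, u} \<in> edges ?G" by (simp add: insert_commute)
    then show "c' u \<noteq> c' v"
      using pc(2)[OF e] free[OF e] free[of v u] unfolding c'_def by metis
  qed
  then have "acyclic_coloring ?G ({1..k} - {1}) c'" by (rule proper_imp_acyclic)
  moreover have "\<forall>v\<in>color_class ?G c 1. l v \<in> {1..k} - {1} \<and> l v \<notin> c ` insert v (nbrs ?G v)"
  proof
    fix v assume "v \<in> color_class ?G c 1"
    then have v: "v \<in> vertices ?G" "c v = 1" by (simp_all add: color_class_def)
    show "l v \<in> {1..k} - {1} \<and> l v \<notin> c ` insert v (nbrs ?G v)"
      using l[OF v(1)] v(2) by auto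
  qed
  moreover have "1 \<in> {1..k}" using k by simp
  ultimately show ?thesis unfolding recoloring_step_possible_def c'_def by blast
qed

lemma ex_stuck_four_coloring:
  "\<exists>c. acyclic_coloring (cubic_graph_of T) {1..4} c \<and> c ` vertices (cubic_graph_of T) = {1..4} \<and>
    \<not> recoloring_step_possible (cubic_graph_of T) 4 c"
proof -
  let ?G = "cubic_graph_of T"
  obtain t where t: "leaf T t" using ex_leaf by blast
  \<comment> \<open>\<open>Hp\<close>, \<open>Hq\<close>, \<open>Hx\<close>, \<open>Hy\<close> get
    four different colors, so that \<open>Hp\<close> and \<open>Hq\<close> see all colors. For
    \<open>Hx\<close> and \<open>Hy\<close> to do so as well, \<open>Hu\<close> must repeat the
    color of \<open>Hy\<close> and \<open>Hv\<close> that of \<open>Hx\<close>; \<open>Hw\<close>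
    then takes a color different from these two.\<close>
  define f :: "h3_vertex \<Rightarrow> nat" where
    "f = (\<lambda>h. case h of Hw \<Rightarrow> 1 | Hu \<Rightarrow> 4 | Hv \<Rightarrow> 3 | Hx \<Rightarrow> 3 | Hy \<Rightarrow> 4 | Hp \<Rightarrow> 1 | Hq \<Rightarrow> 2)"
  \<comment> \<open>The color 1 at corners is a placeholder: the greedy extension keeps the values
    on the copy at \<open>t\<close> only.\<close>
  define c0 :: "'a cubic_vertex \<Rightarrow> nat" where "c0 = (\<lambda>z. case z of Gadget _ h \<Rightarrow> f h | Corner _ _ \<Rightarrow> 1)"
  define S where "S = range (Gadget t)"
  have "f h \<in> {1..4}" for h by (cases h) (simp_all add: f_def)
  then have 1: "c0 ` S \<subseteq> {1..4}" unfolding S_def c0_def by auto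
  have 2: "c0 u \<noteq> c0 v" if uv: "u \<in> S" "v \<in> S" "{u, v} \<in> edges ?G" for u v
  proof -
    obtain g h where gh: "u = Gadget t g" "v = Gadget t h" using uv unfolding S_def by blast
    have "{g, h} \<in> edges H3" using edge_gadget_same_owner[of t g v] uv gh by auto
    then have "f g \<noteq> f h" unfolding H3_edge_iff f_def by auto
    then show ?thesis using gh by (simp add: c0_def)
  qed
  have SV: "S \<subseteq> vertices ?G" using t unfolding S_def cubic_graph_of_def by (auto simp: H3_def)
  have fin: "finite (vertices ?G)" using simple_cubic_graph by (simp add: simple_graph_def)
  have deg: "card (nbrs ?G v) < card {1..4::nat}" if "v \<in> vertices ?G" for v
    using degree_cubic_graph[OF that] by simp
  obtain c where c: "\<forall>v\<in>S. c v = c0 v" "c ` (S \<union> vertices ?G) \<subseteq> {1..4}"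
    "\<forall>u\<in>S \<union> vertices ?G. \<forall>v\<in>S \<union> vertices ?G. {u, v} \<in> edges ?G \<longrightarrow> c u \<noteq> c v"
    using greedy_extension[OF deg simple_cubic_graph 1 2 fin] by blast
  have "proper_coloring ?G {1..4} c"
    unfolding proper_coloring_def
    using c(2,3) edge_simple_graph[OF simple_cubic_graph] by blast
  then have "acyclic_coloring ?G {1..4} c" by (rule proper_imp_acyclic)
  moreover have cf: "c (Gadget t h) = f h" for h using c(1) by (simp add: S_def c0_def)
  have all4: "{1..4} = {1, 2, 3, 4::nat}" by auto
  have dominating: "\<exists>v\<in>color_class ?G c i. {1..4} \<subseteq> c ` insert v (nbrs ?G v)" if "i \<in> {1..4}" for i
  proof -
    have n: "Gadget t h \<in> nbrs ?G (Gadget t g)" if "{h, g} \<in> edges H3" for g h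
      using that t mem_nbrs_iff[OF simple_cubic_graph] unfolding cubic_graph_edge_iff by blast
    have dom: "{1..4} \<subseteq> c ` insert (Gadget t g) (nbrs ?G (Gadget t g))"
      if "f ` insert g {h. {h, g} \<in> edges H3} = {1, 2, 3, 4}" for g
    proof -
      have "{1..4} = c ` insert (Gadget t g) (Gadget t ` {h. {h, g} \<in> edges H3})"
        using that cf all4 by (simp add: image_image)
      also have "\<dots> \<subseteq> c ` insert (Gadget t g) (nbrs ?G (Gadget t g))"
        using n by (intro image_mono) auto
      finally show ?thesis .
    qed
    have sees: "f ` insert g {h. {h, g} \<in> edges H3} = {1, 2, 3, 4}" if "g \<in> {Hp, Hq, Hx, Hy}" for g
    proof -
      have "{h. {h, Hp} \<in> edges H3} = {Hx, Hy, Hq}" "{h. {h, Hq} \<in> edges H3} = {Hx, Hy, Hp}"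
        "{h. {h, Hx} \<in> edges H3} = {Hu, Hp, Hq}" "{h. {h, Hy} \<in> edges H3} = {Hv, Hp, Hq}"
        unfolding H3_edge_iff by auto
      then show ?thesis using that
        by (elim insertE emptyE) (simp_all add: f_def insert_commute)
    qed
    have "\<exists>g\<in>{Hp, Hq, Hx, Hy}. f g = i" using that unfolding all4 by (auto simp: f_def)
    then obtain g where "g \<in> {Hp, Hq, Hx, Hy}" "f g = i" by blast
    moreover from this have "Gadget t g \<in> color_class ?G c i"
      using SV cf unfolding color_class_def S_def by auto
    ultimately show ?thesis using dom[OF sees] by blast
  qed
  moreover have "c ` vertices ?G = {1..4}"
  proof
    show "c ` vertices ?G \<subseteq> {1..4}" using c(2) by blast
    show "{1..4} \<subseteq> c ` vertices ?G" using dominating unfolding color_class_def by blast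
  qed
  \<comment> \<open>For any color \<open>i\<close>, the dominating vertex of its class sees all four
    colors and leaves no value for \<open>l\<close>.\<close>
  moreover have "\<not> recoloring_step_possible ?G 4 c"
    using dominating unfolding recoloring_step_possible_def by (meson DiffD1 subsetD)
  ultimately show ?thesis by blast
qed

end

theorem theorem3p5:
  fixes T :: "'a ugraph"
  assumes "cubic_tree T"
  shows "acyclic_b_chromatic_number (cubic_graph_of T) = 4"
proof -
  let ?M = "{k. \<exists>c. acyclic_coloring (cubic_graph_of T) {1..k} c \<and>
    c ` vertices (cubic_graph_of T) = {1..k} \<and> \<not> recoloring_step_possible (cubic_graph_of T) k c}"
  have le: "k \<le> 4" if "k \<in> ?M" for k
  proof (rule ccontr)
    assume "\<not> k \<le> 4"
    then have "5 \<le> k" by simp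
    then show False using that recoloring_step_if_five_colors[OF assms] by blast
  qed
  \<comment> \<open>\<open>Max\<close> is meaningful only on finite nonempty sets; the bound gives
    finiteness and the member 4 attains it.\<close>
  then have "finite ?M" by (meson finite_nat_set_iff_bounded_le)
  moreover have "4 \<in> ?M" using ex_stuck_four_coloring[OF assms] by (rule CollectI)
  ultimately show ?thesis
    unfolding acyclic_b_chromatic_number_def using le by (intro Max_eqI)
qed

end
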